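(* Let $(r_k)_{k\in\mathbb{Z}}$ be covariance coefficients with $\sum_{k\in\mathbb{Z}}|r_k|<\infty$ and $r_0\neq 0$, and let $R_T$, $V_T$, $\boldsymbol{\Upsilon}$ be defined from them as in the context. Let $N=N(T)$ be positive integers with $N/T\to c$ as $T\to\infty$, where $0<c<\infty$. Let $\widehat R^b_T$ be the $T\times T$ Toeplitz matrix with entries $[\widehat R^b_T]_{i,j}=\hat r^b_{j-i,T}$, $0\le i,j\le T-1$, where for $|k|\le T-1$ $$\hat{r}_{k,T}^b=\frac{1}{NT}\sum_{n=0}^{N-1}\sum_{t=0}^{T-1} v_{n,t+k}\,v_{n,t}^*\,\mathbf{1}_{0\le t+k\le T-1}.$$ Then, for any $x>0$, $$\mathbb{P}\left[\left\|\widehat R_T^b-R_T\right\|>x\right]\le \exp\left(-cT\left(\frac{x}{\|\boldsymbol{\Upsilon}\|_\infty}-\log\left(1+\frac{x}{\|\boldsymbol{\Upsilon}\|_\infty}\right)+o(1)\right)\right),$$ where $o(1)$ denotes a deterministic quantity, depending on $x$, that tends to $0$ as $T\to\infty$.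
   Context: $(r_k)_{k\in\mathbb{Z}}$ is a doubly infinite complex sequence of covariance coefficients: for every $T\ge 1$ the $T\times T$ Toeplitz matrix $R_T$ with entries $[R_T]_{i,j}=r_{j-i}$, $0\le i,j\le T-1$, is Hermitian nonnegative definite. For each $T$, $W_T$ is an $N\times T$ random matrix with independent $\mathcal{CN}(0,1)$ (standard circularly symmetric complex Gaussian) entries, and $V_T=[v_{n,t}]_{0\le n\le N-1,\,0\le t\le T-1}=W_TR_T^{1/2}$, where $R_T^{1/2}$ is any $T\times T$ matrix with $(R_T^{1/2})^{\mathsf H}R_T^{1/2}=R_T$; thus the rows of $V_T$ are independent and $\mathbb{E}[v_{n,t+k}v_{n,t}^*]=r_k$. Here $(\cdot)^*$ is complex conjugation and $(\cdot)^{\mathsf H}$ the Hermitian transpose. The function $\boldsymbol{\Upsilon}$ is $\boldsymbol{\Upsilon}(\lambda)=\sum_{k=-\infty}^{\infty}r_ke^{-\mathrm{i}k\lambda}$, $\lambda\in[0,2\pi)$, and $\|\boldsymbol{\Upsilon}\|_\infty$ is its sup norm. $\|\cdot\|$ applied to a matrix is the spectral norm. *)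

theory Defs
  imports
    "HOL-Probability.Probability"
    "Jordan_Normal_Form.Schur_Decomposition"
begin

(* Matrices are those of Jordan_Normal_Form, whose dimensions are terms, with indices from 0;
   HOL-Analysis also declares "$". *)
no_notation vec_nth (infixl \<open>$\<close> 90)

definition vec_l2norm :: "complex vec \<Rightarrow> real" where
  "vec_l2norm v = L2_set (\<lambda>i. cmod (v $ i)) {..<dim_vec v}"

definition spectral_norm :: "complex mat \<Rightarrow> real" where
  "spectral_norm A =
     (SUP v \<in> {v \<in> carrier_vec (dim_col A). vec_l2norm v \<le> 1}. vec_l2norm (A *\<^sub>v v))"

definition hermitian_nonneg_definite :: "complex mat \<Rightarrow> bool" where
  "hermitian_nonneg_definite A \<longleftrightarrow>
     square_mat A \<and> mat_adjoint A = A \<and>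
     (\<forall>v \<in> carrier_vec (dim_row A). 0 \<le> Re ((A *\<^sub>v v) \<bullet>c v))"

(* Convention: the (i, j) entry is r (j - i), not r (i - j). *)
definition toeplitz :: "nat \<Rightarrow> (int \<Rightarrow> complex) \<Rightarrow> complex mat" where
  "toeplitz T r = Matrix.mat T T (\<lambda>(i, j). r (int j - int i))"

definition covariance_coefficients :: "(int \<Rightarrow> complex) \<Rightarrow> bool" where
  "covariance_coefficients r \<longleftrightarrow> (\<forall>T\<ge>1. hermitian_nonneg_definite (toeplitz T r))"

definition spectral_density :: "(int \<Rightarrow> complex) \<Rightarrow> real \<Rightarrow> complex" where
  "spectral_density r lam = (\<Sum>\<^sub>\<infinity>k\<in>UNIV. r k * exp (- \<i> * of_int k * complex_of_real lam))"

definition spectral_density_sup :: "(int \<Rightarrow> complex) \<Rightarrow> real" where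
  "spectral_density_sup r = (SUP lam \<in> {0..<2 * pi}. cmod (spectral_density r lam))"

(* Density of CN(0,1) with respect to Lebesgue measure on the complex plane: real and
   imaginary parts are independent centred Gaussians of variance 1/2 each. *)
definition std_complex_normal_density :: "complex \<Rightarrow> real" where
  "std_complex_normal_density z = exp (- (cmod z)\<^sup>2) / pi"

definition std_complex_gaussian_matrix ::
    "'a measure \<Rightarrow> nat \<Rightarrow> nat \<Rightarrow> ('a \<Rightarrow> complex mat) \<Rightarrow> bool" where
  "std_complex_gaussian_matrix M n m W \<longleftrightarrow>
     (\<forall>\<omega> \<in> space M. W \<omega> \<in> carrier_mat n m) \<and>
     prob_space.indep_vars M (\<lambda>_. borel) (\<lambda>(i, j) \<omega>. W \<omega> $$ (i, j)) ({..<n} \<times> {..<m}) \<and>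
     (\<forall>i<n. \<forall>j<m. distributed M lborel (\<lambda>\<omega>. W \<omega> $$ (i, j))
        (\<lambda>z. ennreal (std_complex_normal_density z)))"

(* Columns of V are times: the estimate of r k pairs v_{t+k} with the conjugate of v_t. *)
definition biased_autocov :: "nat \<Rightarrow> nat \<Rightarrow> complex mat \<Rightarrow> int \<Rightarrow> complex" where
  "biased_autocov N T V k =
     1 / (of_nat N * of_nat T) *
     (\<Sum>n<N. \<Sum>t<T. if 0 \<le> int t + k \<and> int t + k \<le> int T - 1
                     then V $$ (n, nat (int t + k)) * cnj (V $$ (n, t)) else 0)"

end

theory Submission
  imports Defs "HOL-Real_Asymp.Real_Asymp"
begin

text \<open>
  A \<open>T \<times> T\<close> Toeplitz matrix is a compression of the circulant matrix of size \<open>2 T\<close> with the same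
  symbol, so its spectral norm is at most the maximum of the modulus of the symbol over the \<open>2 T\<close>
  Fourier frequencies: no interpolation between frequencies is needed.  At a fixed frequency the
  symbol of the estimator is the averaged periodogram, whose mean is the Fejer mean of the spectral
  density, and which is that mean times a normalised sum of \<open>N\<close> squared moduli of independent complex
  Gaussians.  The exponential moments are computed by integrating out one Gaussian entry at a time,
  and Chernoff's bound gives for both tails the exponent \<open>N (y - ln (1 + y))\<close> with
  \<open>y = (x - \<delta>) / (\<Upsilon> + \<delta>)\<close>, where \<open>\<Upsilon>\<close> is the supremum of the spectral density and \<open>\<delta>\<close> the vanishing
  Fejer bias.  The union bound costs a factor \<open>4 T\<close>, which is absorbed in the \<open>o(1)\<close> term.
\<close>

section \<open>Exponential moments of complex Gaussian quadratic forms\<close>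

definition cgauss :: "complex measure" where
  "cgauss = density lborel (\<lambda>z. ennreal (std_complex_normal_density z))"

lemma sets_cgauss [measurable_cong, simp]: "sets cgauss = sets borel"
  by (simp add: cgauss_def)

lemma space_cgauss [simp]: "space cgauss = UNIV"
  by (simp add: cgauss_def)

lemma borel_measurable_std_complex_normal_density [measurable]:
  "std_complex_normal_density \<in> borel_measurable borel"
  unfolding std_complex_normal_density_def by measurable

text \<open>The plane has real dimension two, so scaling by \<open>c\<close> has Jacobian
  \<open>c^2\<close>.\<close>

lemma nn_integral_lborel_complex_affine:
  fixes f :: "complex \<Rightarrow> ennreal"
  assumes [measurable]: "f \<in> borel_measurable borel" and "0 < c"
  shows "(\<integral>\<^sup>+w. f w \<partial>lborel) = ennreal (c^2) * (\<integral>\<^sup>+w. f (t + of_real c * w) \<partial>lborel)"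
proof -
  have "(\<integral>\<^sup>+w. f w \<partial>lborel) =
      (\<integral>\<^sup>+w. f w \<partial>density (distr lborel borel (\<lambda>x. t + c *\<^sub>R x)) (\<lambda>_. \<bar>c\<bar>^DIM(complex)))"
    using lborel_affine[of c t] \<open>0 < c\<close> by simp
  then show ?thesis
    using \<open>0 < c\<close> by (simp add: nn_integral_density nn_integral_distr nn_integral_cmult scaleR_conv_of_real)
qed

text \<open>Completing the square in \<open>w\<close>. The left side is, up to sign, the exponent of
  the Gaussian integrand below; on the right \<open>w\<close> occurs only in one shifted modulus,
  which an affine substitution removes.\<close>

lemma cmod_complete_square:
  fixes z b w :: complex and s :: real
  defines "A \<equiv> 1 + s * (cmod b)\<^sup>2"
  assumes "A \<noteq> 0"
  shows "s * (cmod (z + b * w))\<^sup>2 + (cmod w)\<^sup>2 =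
    A * (cmod (w + of_real s * cnj b * z / of_real A))\<^sup>2 + s * (cmod z)\<^sup>2 / A"
proof -
  \<comment> \<open>Multiplying by \<open>A\<close> clears denominators, and a squared modulus is a
    product with the conjugate, so a polynomial identity remains.\<close>
  have "complex_of_real (A * (s * (cmod (z + b * w))\<^sup>2 + (cmod w)\<^sup>2)) =
    of_real (A * (A * (cmod (w + of_real s * cnj b * z / of_real A))\<^sup>2 + s * (cmod z)\<^sup>2 / A))"
  proof -
    have A: "complex_of_real A = 1 + of_real s * (b * cnj b)"
      by (simp only: A_def of_real_add of_real_mult complex_norm_square of_real_1)
    have nz: "complex_of_real A \<noteq> 0" using assms(2) by (simp only: of_real_eq_0_iff not_False_eq_True)
    define y where "y = w + of_real s * cnj b * z / of_real A"
    have y: "of_real A * y = of_real A * w + of_real s * cnj b * z"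
      unfolding y_def using nz by (simp add: field_simps)
    have y': "of_real A * cnj y = of_real A * cnj w + of_real s * b * cnj z"
      unfolding y_def using nz by (simp add: field_simps)
    have "complex_of_real (A * (A * (cmod y)\<^sup>2 + s * (cmod z)\<^sup>2 / A)) =
       (of_real A * y) * (of_real A * cnj y) + of_real s * (z * cnj z)"
      unfolding of_real_add of_real_mult of_real_divide complex_norm_square
      using nz by (simp add: field_simps)
    also have "\<dots> = of_real A * (of_real s * ((z + b * w) * cnj (z + b * w)) + w * cnj w)"
      unfolding y y' unfolding A by (simp add: algebra_simps)
    also have "\<dots> = complex_of_real (A * (s * (cmod (z + b * w))\<^sup>2 + (cmod w)\<^sup>2))"
      by (simp only: of_real_mult of_real_add complex_norm_square)
    finally show ?thesis unfolding y_def by (rule sym)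
  qed
  then show ?thesis using assms(2) by (metis mult_cancel_left of_real_eq_iff)
qed

text \<open>After completing the square the integrand is a constant times the same density at an
  affine image of \<open>w\<close>. The Gaussian integral itself is not evaluated: total mass one is
  a hypothesis, later read off from the law of a matrix entry.\<close>

lemma nn_integral_cgauss_exp_quadratic:
  assumes "prob_space cgauss" and pos: "1 + s * (cmod b)\<^sup>2 > 0"
  shows "(\<integral>\<^sup>+w. ennreal (exp (- s * (cmod (z + b * w))\<^sup>2)) \<partial>cgauss) =
    ennreal (1 / (1 + s * (cmod b)\<^sup>2) * exp (- (s / (1 + s * (cmod b)\<^sup>2)) * (cmod z)\<^sup>2))"
proof -
  define A where "A = 1 + s * (cmod b)\<^sup>2"
  define K where "K = exp (- (s / A) * (cmod z)\<^sup>2)"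
  define c where "c = sqrt A"
  define t where "t = of_real c * (of_real s * cnj b * z / of_real A)"
  have A: "A > 0" using pos by (simp add: A_def)
  have c: "c > 0" "c^2 = A" using A by (auto simp: c_def)
  let ?d = "\<lambda>w. ennreal (std_complex_normal_density w)"
  have [simp]: "0 \<le> std_complex_normal_density w" for w
    by (simp add: std_complex_normal_density_def)
  have one: "(\<integral>\<^sup>+w. ?d w \<partial>lborel) = 1"
    using prob_space.emeasure_space_1[OF assms(1)] by (simp add: cgauss_def emeasure_density)
  have "(\<integral>\<^sup>+w. ennreal (exp (- s * (cmod (z + b * w))\<^sup>2)) \<partial>cgauss) =
      (\<integral>\<^sup>+w. ?d w * ennreal (exp (- s * (cmod (z + b * w))\<^sup>2)) \<partial>lborel)"
    unfolding cgauss_def by (simp add: nn_integral_density)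
  also have "\<dots> = (\<integral>\<^sup>+w. ennreal K * ?d (t + of_real c * w) \<partial>lborel)"
  proof (rule nn_integral_cong)
    fix w
    have "t + of_real c * w = of_real c * (w + of_real s * cnj b * z / of_real A)"
      unfolding t_def by (simp add: algebra_simps)
    then have n: "(cmod (t + of_real c * w))\<^sup>2 = A * (cmod (w + of_real s * cnj b * z / of_real A))\<^sup>2"
      using c by (simp add: norm_mult power_mult_distrib)
    have "std_complex_normal_density w * exp (- s * (cmod (z + b * w))\<^sup>2) =
      exp (- (s * (cmod (z + b * w))\<^sup>2 + (cmod w)\<^sup>2)) / pi"
      by (simp add: std_complex_normal_density_def flip: exp_add)
    also have "s * (cmod (z + b * w))\<^sup>2 + (cmod w)\<^sup>2 = (cmod (t + of_real c * w))\<^sup>2 + s * (cmod z)\<^sup>2 / A"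
      unfolding n using cmod_complete_square[of s b z w] A by (simp add: A_def)
    also have "exp (- ((cmod (t + of_real c * w))\<^sup>2 + s * (cmod z)\<^sup>2 / A)) / pi
        = K * std_complex_normal_density (t + of_real c * w)"
      by (simp add: K_def std_complex_normal_density_def flip: exp_add)
    finally show "?d w * ennreal (exp (- s * (cmod (z + b * w))\<^sup>2)) =
        ennreal K * ?d (t + of_real c * w)"
      by (simp add: K_def flip: ennreal_mult)
  qed
  also have "\<dots> = ennreal K * (\<integral>\<^sup>+w. ?d (t + of_real c * w) \<partial>lborel)"
    by (simp add: nn_integral_cmult)
  also have "(\<integral>\<^sup>+w. ?d (t + of_real c * w) \<partial>lborel) = ennreal (1 / A)"
  proof -
    have "ennreal A * (\<integral>\<^sup>+w. ?d (t + of_real c * w) \<partial>lborel) = 1"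
      using nn_integral_lborel_complex_affine[of ?d c t] c one by simp
    then have "ennreal (1/A) * (ennreal A * (\<integral>\<^sup>+w. ?d (t + of_real c * w) \<partial>lborel)) = ennreal (1/A)"
      by simp
    then show ?thesis using A by (simp flip: mult.assoc ennreal_mult)
  qed
  finally show ?thesis
    using A by (simp add: K_def A_def ennreal_mult' mult.commute flip: ennreal_mult)
qed

text \<open>
  Integrating out one coordinate reproduces the same integrand with \<open>s\<close> replaced by
  \<open>s / (1 + s \<bar>b i\<bar>\<^sup>2)\<close>, which is why \<open>z\<close> is kept general; \<open>s\<close> may have either sign.
\<close>
lemma nn_integral_PiM_cgauss_exp_quadratic:
  assumes "prob_space cgauss" and "finite I" and "1 + s * (\<Sum>i\<in>I. (cmod (b i))\<^sup>2) > 0"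
  shows "(\<integral>\<^sup>+\<omega>. ennreal (exp (- s * (cmod (z + (\<Sum>i\<in>I. b i * \<omega> i)))\<^sup>2)) \<partial>PiM I (\<lambda>_. cgauss)) =
    ennreal (1 / (1 + s * (\<Sum>i\<in>I. (cmod (b i))\<^sup>2)) *
      exp (- (s / (1 + s * (\<Sum>i\<in>I. (cmod (b i))\<^sup>2))) * (cmod z)\<^sup>2))"
  using assms(2,3)
proof (induction I arbitrary: s)
  case empty
  interpret G: prob_space cgauss by fact
  show ?case by (simp add: PiM_empty)
next
  case (insert i I)
  interpret G: prob_space cgauss by fact
  interpret product_sigma_finite "\<lambda>_. cgauss" ..
  define S where "S = (\<Sum>i\<in>I. (cmod (b i))\<^sup>2)"
  define u where "u = (cmod (b i))\<^sup>2"
  define s' where "s' = s / (1 + s * u)"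
  have [simp]: "0 \<le> S" "0 \<le> u" by (auto simp: S_def u_def sum_nonneg)
  have sum: "(\<Sum>i\<in>insert i I. (cmod (b i))\<^sup>2) = u + S"
    using insert by (simp add: S_def u_def)
  have pos: "1 + s * (u + S) > 0"
    using insert.prems unfolding sum .
  \<comment> \<open>For negative \<open>s\<close> this needs positivity for the full sum: discarding
    the nonpositive \<open>s * S\<close> only increases the left side.\<close>
  have A: "1 + s * u > 0"
  proof (cases "s \<ge> 0")
    case True
    then show ?thesis by (simp add: add_pos_nonneg)
  next
    case False
    then have "s * S \<le> 0" by (simp add: mult_nonpos_nonneg)
    then show ?thesis using pos by (simp add: algebra_simps)
  qed
  \<comment> \<open>The denominators telescope: a step with \<open>u\<close> followed by one with
    \<open>S\<close> acts like a single step with \<open>u + S\<close>.\<close>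
  have B: "1 + s' * S = (1 + s * (u + S)) / (1 + s * u)"
    unfolding s'_def using A by (simp add: field_simps)
  have IH: "(\<integral>\<^sup>+\<omega>. ennreal (exp (- s' * (cmod (z + (\<Sum>i\<in>I. b i * \<omega> i)))\<^sup>2)) \<partial>PiM I (\<lambda>_. cgauss)) =
    ennreal (1 / (1 + s' * S) * exp (- (s' / (1 + s' * S)) * (cmod z)\<^sup>2))"
    unfolding S_def
    by (rule insert.IH) (use A B pos in \<open>auto simp: S_def\<close>)
  have "(\<integral>\<^sup>+\<omega>. ennreal (exp (- s * (cmod (z + (\<Sum>i\<in>insert i I. b i * \<omega> i)))\<^sup>2))
        \<partial>PiM (insert i I) (\<lambda>_. cgauss)) =
     (\<integral>\<^sup>+\<omega>. (\<integral>\<^sup>+w. ennreal (exp (- s * (cmod (z + (\<Sum>j\<in>insert i I. b j * (fun_upd \<omega> i w) j)))\<^sup>2)) \<partial>cgauss)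
        \<partial>PiM I (\<lambda>_. cgauss))"
    using insert by (intro product_nn_integral_insert) auto
  also have "\<dots> = (\<integral>\<^sup>+\<omega>. (\<integral>\<^sup>+w. ennreal (exp (- s * (cmod ((z + (\<Sum>j\<in>I. b j * \<omega> j)) + b i * w))\<^sup>2)) \<partial>cgauss)
        \<partial>PiM I (\<lambda>_. cgauss))"
  proof (intro nn_integral_cong)
    fix \<omega> w
    have "(\<Sum>j\<in>I. b j * (fun_upd \<omega> i w) j) = (\<Sum>j\<in>I. b j * \<omega> j)"
      using insert by (intro sum.cong) auto
    then have "(\<Sum>j\<in>insert i I. b j * (fun_upd \<omega> i w) j) = (\<Sum>j\<in>I. b j * \<omega> j) + b i * w"
      using insert by simp
    then show "ennreal (exp (- s * (cmod (z + (\<Sum>j\<in>insert i I. b j * (fun_upd \<omega> i w) j)))\<^sup>2)) =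
       ennreal (exp (- s * (cmod ((z + (\<Sum>j\<in>I. b j * \<omega> j)) + b i * w))\<^sup>2))"
      by (simp add: add.assoc)
  qed
  also have "\<dots> = (\<integral>\<^sup>+\<omega>. ennreal (1 / (1 + s * u)) * ennreal (exp (- s' * (cmod (z + (\<Sum>j\<in>I. b j * \<omega> j)))\<^sup>2))
        \<partial>PiM I (\<lambda>_. cgauss))"
    unfolding u_def s'_def
    by (intro nn_integral_cong, subst nn_integral_cgauss_exp_quadratic[OF assms(1)])
       (use A in \<open>auto simp: u_def simp flip: ennreal_mult\<close>)
  also have "\<dots> = ennreal (1 / (1 + s * u)) *
      ennreal (1 / (1 + s' * S) * exp (- (s' / (1 + s' * S)) * (cmod z)\<^sup>2))"
    unfolding IH[symmetric] by (intro nn_integral_cmult) simp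
  also have "\<dots> = ennreal (1 / (1 + s * (u + S)) * exp (- (s / (1 + s * (u + S))) * (cmod z)\<^sup>2))"
  proof -
    have "s' / (1 + s' * S) = s / (1 + s * (u + S))"
      unfolding B unfolding s'_def using A pos by simp
    moreover have "1 / (1 + s * u) * (1 / (1 + s' * S)) = 1 / (1 + s * (u + S))"
      unfolding B using A pos by simp
    ultimately show ?thesis
      using A by (simp flip: ennreal_mult' mult.assoc)
  qed
  finally show ?case unfolding sum .
qed

section \<open>From single entries to the rows of a Gaussian matrix\<close>

lemma distr_std_complex_gaussian_entry:
  assumes "std_complex_gaussian_matrix M n m W" "i < n" "j < m"
  shows "distr M borel (\<lambda>\<omega>. W \<omega> $$ (i, j)) = cgauss"
proof -
  have "distributed M lborel (\<lambda>\<omega>. W \<omega> $$ (i, j)) (\<lambda>z. ennreal (std_complex_normal_density z))"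
    using assms by (auto simp: std_complex_gaussian_matrix_def)
  then have "distr M lborel (\<lambda>\<omega>. W \<omega> $$ (i, j)) = cgauss"
    unfolding cgauss_def by (rule distributed_distr_eq_density)
  moreover have "distr M borel (\<lambda>\<omega>. W \<omega> $$ (i, j)) = distr M lborel (\<lambda>\<omega>. W \<omega> $$ (i, j))"
    by (intro distr_cong) auto
  ultimately show ?thesis by simp
qed

lemma borel_measurable_std_complex_gaussian_entry:
  assumes "std_complex_gaussian_matrix M n m W" "i < n" "j < m"
  shows "(\<lambda>\<omega>. W \<omega> $$ (i, j)) \<in> borel_measurable M"
proof -
  have "distributed M lborel (\<lambda>\<omega>. W \<omega> $$ (i, j)) (\<lambda>z. ennreal (std_complex_normal_density z))"
    using assms by (auto simp: std_complex_gaussian_matrix_def)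
  then show ?thesis by (simp add: distributed_def measurable_lborel1)
qed

lemma sum_singleton_Times: "(\<Sum>p\<in>{i} \<times> J. f p) = (\<Sum>j\<in>J. f (i, j))"
  using sum.cartesian_product[of "\<lambda>i j. f (i, j)" J "{i}"] by simp

text \<open>Different rows are functions of disjoint blocks of independent entries, so the
  expectation of the product factors. Each row gives the previous formula at \<open>z = 0\<close>,
  where the exponential factor is one.\<close>

lemma nn_integral_gaussian_rows_exp_quadratic:
  assumes "prob_space M" and W: "std_complex_gaussian_matrix M n m W"
    and "0 < m"
    and pos: "1 + s * (\<Sum>j<m. (cmod (b j))\<^sup>2) > 0"
  shows "(\<integral>\<^sup>+\<omega>. ennreal (exp (- s * (\<Sum>i<n. (cmod (\<Sum>j<m. b j * W \<omega> $$ (i, j)))\<^sup>2))) \<partial>M) =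
    ennreal ((1 / (1 + s * (\<Sum>j<m. (cmod (b j))\<^sup>2))) ^ n)"
proof -
  interpret prob_space M by fact
  define X where "X = (\<lambda>p \<omega>. W \<omega> $$ p)"
  have ind: "indep_vars (\<lambda>_. borel) X ({..<n} \<times> {..<m})"
  proof -
    have "X = (\<lambda>(i, j) \<omega>. W \<omega> $$ (i, j))" by (auto simp: X_def fun_eq_iff)
    then show ?thesis using W by (simp add: std_complex_gaussian_matrix_def)
  qed
  define Y where "Y = (\<lambda>(i :: nat) f. ennreal (exp (- s * (cmod (\<Sum>j<m. b j * f (i, j)))\<^sup>2)))"
  have Y: "Y i \<in> borel_measurable (PiM ({i} \<times> {..<m}) (\<lambda>_. borel))" for i :: nat
    unfolding Y_def by measurable
  have "indep_vars (\<lambda>i. PiM ({i} \<times> {..<m}) (\<lambda>_. borel))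
      (\<lambda>i \<omega>. restrict (\<lambda>p. X p \<omega>) ({i} \<times> {..<m})) {..<n}"
    by (rule indep_vars_restrict[OF ind]) (auto simp: disjoint_family_on_def)
  from indep_vars_compose2[OF this, of Y "\<lambda>_. borel"] Y
  have indY: "indep_vars (\<lambda>_. borel) (\<lambda>i \<omega>. Y i (restrict (\<lambda>p. X p \<omega>) ({i} \<times> {..<m}))) {..<n}"
    by simp
  have row: "(\<integral>\<^sup>+\<omega>. Y i (restrict (\<lambda>p. X p \<omega>) ({i} \<times> {..<m})) \<partial>M) =
      ennreal (1 / (1 + s * (\<Sum>j<m. (cmod (b j))\<^sup>2)))" if "i < n" for i
  proof -
    let ?I = "{i} \<times> {..<m}"
    \<comment> \<open>The density has mass one because it is the law of a random variable, here the
      entry \<open>(i, 0)\<close>, which exists since \<open>m\<close> is positive.\<close>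
    have pr: "prob_space cgauss"
      using distr_std_complex_gaussian_entry[OF W \<open>i < n\<close> \<open>0 < m\<close>]
        borel_measurable_std_complex_gaussian_entry[OF W \<open>i < n\<close> \<open>0 < m\<close>]
        prob_space_distr by metis
    have rv: "random_variable borel (X p)" if "p \<in> ?I" for p
      using that \<open>i < n\<close> borel_measurable_std_complex_gaussian_entry[OF W] by (auto simp: X_def)
    have "indep_vars (\<lambda>_. borel) X ?I"
      using ind by (rule indep_vars_subset) (use \<open>i < n\<close> in auto)
    moreover have "?I \<noteq> {}" using \<open>0 < m\<close> by auto
    ultimately have "distr M (PiM ?I (\<lambda>_. borel)) (\<lambda>\<omega>. restrict (\<lambda>p. X p \<omega>) ?I) =
        PiM ?I (\<lambda>p. distr M borel (X p))"
      using indep_vars_iff_distr_eq_PiM'[where I = ?I and M' = "\<lambda>_. borel" and X = X] rv by simp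
    also have "\<dots> = PiM ?I (\<lambda>p. cgauss)"
      by (rule PiM_cong) (use distr_std_complex_gaussian_entry[OF W] \<open>i < n\<close> in \<open>auto simp: X_def\<close>)
    finally have d: "distr M (PiM ?I (\<lambda>_. borel)) (\<lambda>\<omega>. restrict (\<lambda>p. X p \<omega>) ?I) = \<dots>" .
    have "(\<integral>\<^sup>+\<omega>. Y i (restrict (\<lambda>p. X p \<omega>) ?I) \<partial>M) =
        (\<integral>\<^sup>+f. Y i f \<partial>distr M (PiM ?I (\<lambda>_. borel)) (\<lambda>\<omega>. restrict (\<lambda>p. X p \<omega>) ?I))"
      using Y rv by (subst nn_integral_distr) (auto intro!: measurable_restrict)
    also have "\<dots> = (\<integral>\<^sup>+f. ennreal (exp (- s * (cmod (0 + (\<Sum>p\<in>?I. b (snd p) * f p)))\<^sup>2)) \<partial>PiM ?I (\<lambda>_. cgauss))"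
      unfolding d Y_def by (simp add: sum_singleton_Times)
    also have "\<dots> = ennreal (1 / (1 + s * (\<Sum>p\<in>?I. (cmod (b (snd p)))\<^sup>2)))"
      by (subst nn_integral_PiM_cgauss_exp_quadratic[OF pr]) (use pos in \<open>auto simp: sum_singleton_Times\<close>)
    finally show ?thesis by (simp add: sum_singleton_Times)
  qed
  have "(\<integral>\<^sup>+\<omega>. ennreal (exp (- s * (\<Sum>i<n. (cmod (\<Sum>j<m. b j * W \<omega> $$ (i, j)))\<^sup>2))) \<partial>M) =
      (\<integral>\<^sup>+\<omega>. (\<Prod>i<n. Y i (restrict (\<lambda>p. X p \<omega>) ({i} \<times> {..<m}))) \<partial>M)"
    unfolding Y_def X_def by (simp add: prod_ennreal exp_sum sum_distrib_left sum_negf[symmetric])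
  also have "\<dots> = (\<Prod>i<n. \<integral>\<^sup>+\<omega>. Y i (restrict (\<lambda>p. X p \<omega>) ({i} \<times> {..<m})) \<partial>M)"
    by (rule indep_vars_nn_integral[OF _ indY]) auto
  also have "\<dots> = (\<Prod>i<n. ennreal (1 / (1 + s * (\<Sum>j<m. (cmod (b j))\<^sup>2))))"
    using row by (intro prod.cong) auto
  also have "\<dots> = ennreal ((1 / (1 + s * (\<Sum>j<m. (cmod (b j))\<^sup>2))) ^ n)"
    using pos by (simp add: ennreal_power)
  finally show ?thesis .
qed

section \<open>Chernoff bounds\<close>

text \<open>The difference has derivative \<open>t^2 / (1 + t)\<close>. This bound is what brings
  the lower tail under the upper-tail exponent in \<open>lower_tail_rate\<close>.\<close>

lemma ln_one_plus_ge_quadratic: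
  fixes y :: real
  assumes "0 \<le> y"
  shows "y - y\<^sup>2 / 2 \<le> ln (1 + y)"
proof -
  have "(\<lambda>y. ln (1 + y) - (y - y\<^sup>2 / 2)) 0 \<le> (\<lambda>y. ln (1 + y) - (y - y\<^sup>2 / 2)) y"
  proof (rule DERIV_nonneg_imp_nondecreasing[OF assms])
    fix t :: real assume "0 \<le> t" "t \<le> y"
    then have "((\<lambda>y. ln (1 + y) - (y - y\<^sup>2 / 2)) has_real_derivative (1 / (1 + t) - (1 - t))) (at t)"
      by (auto intro!: derivative_eq_intros)
    moreover have "1 / (1 + t) - (1 - t) = t\<^sup>2 / (1 + t)"
      using \<open>0 \<le> t\<close> by (simp add: field_simps power2_eq_square)
    ultimately show "\<exists>d. ((\<lambda>y. ln (1 + y) - (y - y\<^sup>2 / 2)) has_real_derivative d) (at t) \<and> 0 \<le> d"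
      using \<open>0 \<le> t\<close> by auto
  qed
  then show ?thesis by simp
qed

text \<open>Here \<open>v\<close> stands for \<open>\<theta> * \<sigma>\<close> in Chernoff's bound.
  The left side increases with \<open>v\<close> on \<open>[0, 1)\<close> and equals the right side
  at \<open>v = y / (1 + y)\<close>, so the largest admissible variance is the worst case.\<close>

lemma upper_tail_rate:
  fixes v y :: real
  assumes "0 < y" "0 \<le> v" "v \<le> y / (1 + y)"
  shows "exp (- (v + y\<^sup>2 / (1 + y))) / (1 - v) \<le> exp (- (y - ln (1 + y)))"
proof -
  define w where "w = y / (1 + y)"
  have w: "w < 1" "1 - w = 1 / (1 + y)" "y\<^sup>2 / (1 + y) = y - w"
    using assms unfolding w_def by (auto simp: field_simps power2_eq_square)
  have "v \<le> w" using assms by (simp add: w_def)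
  with w have v: "v \<le> w" "v < 1" by auto
  have "(1 - w) / (1 - v) = 1 - (w - v) / (1 - v)"
    using v by (simp add: field_simps)
  also have "\<dots> \<le> 1 - (w - v)"
  proof -
    have "w - v \<le> (w - v) / (1 - v)"
      using v assms by (simp add: pos_le_divide_eq mult_left_le)
    then show ?thesis by simp
  qed
  also have "\<dots> \<le> exp (- (w - v))"
    using exp_ge_add_one_self[of "- (w - v)"] by linarith
  finally have "(1 - w) / (1 - v) * exp (w - v) \<le> exp (- (w - v)) * exp (w - v)"
    by (intro mult_right_mono) auto
  also have "\<dots> = 1" by (simp flip: exp_add)
  finally have "exp (w - v) / (1 - v) * (1 - w) \<le> 1"
    by (simp add: mult_ac)
  moreover have "0 < 1 - w" using w(1) by simp
  ultimately have "exp (w - v) / (1 - v) \<le> 1 / (1 - w)"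
    by (simp only: pos_le_divide_eq)
  then have "exp (w - v) / (1 - v) * exp (- y) \<le> (1 + y) * exp (- y)"
    using w assms by (intro mult_right_mono) auto
  moreover have "exp (- (v + y\<^sup>2 / (1 + y))) = exp (w - v) * exp (- y)"
    unfolding w by (simp flip: exp_add)
  moreover have "exp (- (y - ln (1 + y))) = (1 + y) * exp (- y)"
    using assms by (simp add: exp_diff exp_minus field_simps)
  ultimately show ?thesis by (simp add: field_simps)
qed

text \<open>Again the left side increases with \<open>v\<close>; at \<open>v = y\<close> the claim
  reduces to \<open>exp (2 * y - y^2) \<le> (1 + y)^2\<close>, which is the quadratic bound on the
  logarithm.\<close>

lemma lower_tail_rate:
  fixes v y :: real
  assumes "0 < y" "0 \<le> v" "v \<le> y"
  shows "exp (v - y\<^sup>2) / (1 + v) \<le> exp (- (y - ln (1 + y)))"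
proof -
  have "(1 + y) / (1 + v) = 1 + (y - v) / (1 + v)"
    using assms by (simp add: field_simps)
  also have "\<dots> \<le> 1 + (y - v)"
    using assms by (simp add: divide_simps) (simp add: algebra_simps mult_left_le mult_mono)
  also have "\<dots> \<le> exp (y - v)"
    using exp_ge_add_one_self[of "y - v"] by linarith
  finally have "(1 + y) / (1 + v) * exp (v - y\<^sup>2) \<le> exp (y - v) * exp (v - y\<^sup>2)"
    by (intro mult_right_mono) auto
  also have "\<dots> = exp (y - y\<^sup>2)" by (simp flip: exp_add)
  also have "\<dots> \<le> exp (2 * ln (1 + y) - y)"
    using ln_one_plus_ge_quadratic[of y] assms by simp
  also have "\<dots> = (1 + y) * exp (- (y - ln (1 + y)))"
  proof -
    have "exp (2 * ln (1 + y) - y) = exp (ln (1 + y)) * exp (- (y - ln (1 + y)))"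
      by (simp flip: exp_add)
    then show ?thesis using assms by simp
  qed
  finally have "(1 + y) * (exp (v - y\<^sup>2) / (1 + v)) \<le> (1 + y) * exp (- (y - ln (1 + y)))"
    by simp
  then show ?thesis using assms by (simp only: mult_le_cancel_left_pos add_pos_pos zero_less_one)
qed

text \<open>The mean of \<open>Q / n\<close> is only known to be at most \<open>B\<close>, and the
  rate depends on \<open>B\<close> alone, so even zero variance is admissible. Both tails obey the
  same exponent, whence the factor two. The second claim serves the union bound.\<close>

lemma gaussian_rows_concentration:
  assumes "prob_space M" and W: "std_complex_gaussian_matrix M n m W" and "0 < m" "0 < n"
    and B: "(\<Sum>j<m. (cmod (b j))\<^sup>2) \<le> B" "0 < B" and h: "0 < h"
  defines "Q \<equiv> \<lambda>\<omega>. \<Sum>i<n. (cmod (\<Sum>j<m. b j * W \<omega> $$ (i, j)))\<^sup>2"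
  shows "measure M {\<omega> \<in> space M. \<bar>Q \<omega> / n - (\<Sum>j<m. (cmod (b j))\<^sup>2)\<bar> \<ge> h}
      \<le> 2 * exp (- real n * (h / B - ln (1 + h / B)))"
    and "{\<omega> \<in> space M. \<bar>Q \<omega> / n - (\<Sum>j<m. (cmod (b j))\<^sup>2)\<bar> \<ge> h} \<in> sets M"
proof -
  interpret prob_space M by fact
  define \<sigma> where "\<sigma> = (\<Sum>j<m. (cmod (b j))\<^sup>2)"
  define y where "y = h / B"
  define E where "E = exp (- (y - ln (1 + y)))"
  have \<sigma>: "0 \<le> \<sigma>" "\<sigma> \<le> B" using B by (auto simp: \<sigma>_def sum_nonneg)
  have y: "0 < y" "h = y * B" using B h by (auto simp: y_def)
  have [measurable]: "(\<lambda>\<omega>. W \<omega> $$ (i, j)) \<in> borel_measurable M" if "i < n" "j < m" for i j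
    using borel_measurable_std_complex_gaussian_entry[OF W that] .
  have Q [measurable]: "Q \<in> borel_measurable M"
    unfolding Q_def by (intro borel_measurable_sum borel_measurable_power borel_measurable_norm 
       borel_measurable_times borel_measurable_const) auto
  show sets: "{\<omega> \<in> space M. \<bar>Q \<omega> / n - (\<Sum>j<m. (cmod (b j))\<^sup>2)\<bar> \<ge> h} \<in> sets M"
    by measurable
  \<comment> \<open>One formula serves both tails: \<open>s\<close> is negative for the upper one
    and positive for the lower one. The indicator matches the form of Chernoff's
    inequalities.\<close>
  have mgf: "(\<integral>\<^sup>+\<omega>. ennreal (exp (- s * Q \<omega>)) * indicator (space M) \<omega> \<partial>M) = ennreal ((1 / (1 + s * \<sigma>)) ^ n)"
    if "1 + s * \<sigma> > 0" for s
  proof -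
    have "(\<integral>\<^sup>+\<omega>. ennreal (exp (- s * Q \<omega>)) * indicator (space M) \<omega> \<partial>M) = (\<integral>\<^sup>+\<omega>. ennreal (exp (- s * Q \<omega>)) \<partial>M)"
      by (intro nn_integral_cong) auto
    then show ?thesis
      using nn_integral_gaussian_rows_exp_quadratic[OF assms(1) W \<open>0 < m\<close>, of s b] that
      by (simp add: Q_def \<sigma>_def)
  qed
  have up: "measure M {\<omega> \<in> space M. Q \<omega> \<ge> n * (\<sigma> + h)} \<le> E ^ n"
  proof -
    \<comment> \<open>The optimal Chernoff parameter when the variance equals \<open>B\<close>; it
      keeps \<open>\<theta> * \<sigma>\<close> below one, so the moment is finite.\<close>
    define \<theta> where "\<theta> = y / (1 + y) / B"
    have \<theta>: "0 < \<theta>" using y B by (simp add: \<theta>_def)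
    have v: "0 \<le> \<theta> * \<sigma>" "\<theta> * \<sigma> \<le> y / (1 + y)" "\<theta> * h = y\<^sup>2 / (1 + y)"
    proof -
      have "\<theta> * \<sigma> \<le> \<theta> * B" using \<sigma> \<theta> by simp
      then show "\<theta> * \<sigma> \<le> y / (1 + y)" using B by (simp add: \<theta>_def)
    qed (use \<sigma> \<theta> y B in \<open>auto simp: \<theta>_def power2_eq_square\<close>)
    moreover have "y / (1 + y) < 1" using y by simp
    ultimately have v1: "\<theta> * \<sigma> < 1" by linarith
    have "emeasure M {\<omega> \<in> space M. Q \<omega> \<ge> n * (\<sigma> + h)} \<le>
       ennreal (exp (- \<theta> * (n * (\<sigma> + h)))) * (\<integral>\<^sup>+\<omega>. ennreal (exp (\<theta> * Q \<omega>)) * indicator (space M) \<omega> \<partial>M)"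
      by (rule Chernoff_ineq_nn_integral_ge) (use \<theta> in auto)
    also have "\<dots> = ennreal (exp (- \<theta> * (n * (\<sigma> + h))) * (1 / (1 - \<theta> * \<sigma>)) ^ n)"
      using mgf[of "- \<theta>"] v1 by (simp add: ennreal_mult'')
    also have "exp (- \<theta> * (n * (\<sigma> + h))) = exp (- (\<theta> * \<sigma> + \<theta> * h)) ^ n"
      by (simp add: algebra_simps flip: exp_of_nat_mult)
    also have "\<dots> * (1 / (1 - \<theta> * \<sigma>)) ^ n = (exp (- (\<theta> * \<sigma> + y\<^sup>2 / (1 + y))) / (1 - \<theta> * \<sigma>)) ^ n"
      unfolding v(3) by (simp add: power_divide)
    also have "ennreal \<dots> \<le> ennreal (E ^ n)"
      unfolding E_def using upper_tail_rate[OF y(1) v(1,2)] v1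
      by (intro ennreal_leI power_mono) auto
    finally show ?thesis by (simp add: emeasure_eq_measure E_def)
  qed
  have lo: "measure M {\<omega> \<in> space M. Q \<omega> \<le> n * (\<sigma> - h)} \<le> E ^ n"
  proof -
    \<comment> \<open>For variance \<open>B\<close> the optimum would be
      \<open>y / (1 - y) / B\<close>, which is available only for \<open>y < 1\<close>; this choice
      works for every \<open>y\<close> and still reaches the required rate.\<close>
    define \<theta> where "\<theta> = y / B"
    have \<theta>: "0 < \<theta>" using y B by (simp add: \<theta>_def)
    have v: "0 \<le> \<theta> * \<sigma>" "\<theta> * \<sigma> \<le> y" "\<theta> * h = y\<^sup>2"
    proof -
      have "\<theta> * \<sigma> \<le> \<theta> * B" using \<sigma> \<theta> by simp
      then show "\<theta> * \<sigma> \<le> y" using B by (simp add: \<theta>_def)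
    qed (use \<sigma> \<theta> y B in \<open>auto simp: \<theta>_def power2_eq_square\<close>)
    have v1: "1 + \<theta> * \<sigma> > 0" using v by linarith
    have "emeasure M {\<omega> \<in> space M. Q \<omega> \<le> n * (\<sigma> - h)} \<le>
       ennreal (exp (\<theta> * (n * (\<sigma> - h)))) * (\<integral>\<^sup>+\<omega>. ennreal (exp (- \<theta> * Q \<omega>)) * indicator (space M) \<omega> \<partial>M)"
      by (rule Chernoff_ineq_nn_integral_le) (use \<theta> in auto)
    also have "\<dots> = ennreal (exp (\<theta> * (n * (\<sigma> - h))) * (1 / (1 + \<theta> * \<sigma>)) ^ n)"
      using mgf[of \<theta>] v1 by (simp add: ennreal_mult'')
    also have "exp (\<theta> * (n * (\<sigma> - h))) = exp (\<theta> * \<sigma> - \<theta> * h) ^ n"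
      by (simp add: algebra_simps flip: exp_of_nat_mult)
    also have "\<dots> * (1 / (1 + \<theta> * \<sigma>)) ^ n = (exp (\<theta> * \<sigma> - y\<^sup>2) / (1 + \<theta> * \<sigma>)) ^ n"
      unfolding v(3) by (simp add: power_divide)
    also have "ennreal \<dots> \<le> ennreal (E ^ n)"
      unfolding E_def using lower_tail_rate[OF y(1) v(1,2)] v1
      by (intro ennreal_leI power_mono) auto
    finally show ?thesis by (simp add: emeasure_eq_measure E_def)
  qed
  have "{\<omega> \<in> space M. \<bar>Q \<omega> / n - \<sigma>\<bar> \<ge> h} \<subseteq>
      {\<omega> \<in> space M. Q \<omega> \<ge> n * (\<sigma> + h)} \<union> {\<omega> \<in> space M. Q \<omega> \<le> n * (\<sigma> - h)}"
    using \<open>0 < n\<close> by (auto simp: abs_real_def field_simps split: if_splits)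
  then have "measure M {\<omega> \<in> space M. \<bar>Q \<omega> / n - \<sigma>\<bar> \<ge> h} \<le>
      measure M ({\<omega> \<in> space M. Q \<omega> \<ge> n * (\<sigma> + h)} \<union> {\<omega> \<in> space M. Q \<omega> \<le> n * (\<sigma> - h)})"
    by (rule finite_measure_mono) measurable
  also have "\<dots> \<le> measure M {\<omega> \<in> space M. Q \<omega> \<ge> n * (\<sigma> + h)} + measure M {\<omega> \<in> space M. Q \<omega> \<le> n * (\<sigma> - h)}"
    by (rule measure_Un_le) measurable
  also have "\<dots> \<le> 2 * E ^ n" using up lo by simp
  also have "E ^ n = exp (- real n * (y - ln (1 + y)))"
    by (simp add: E_def algebra_simps flip: exp_of_nat_mult)
  finally show "measure M {\<omega> \<in> space M. \<bar>Q \<omega> / n - (\<Sum>j<m. (cmod (b j))\<^sup>2)\<bar> \<ge> h}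
      \<le> 2 * exp (- real n * (h / B - ln (1 + h / B)))"
    by (simp add: \<sigma>_def y_def)
qed

section \<open>Toeplitz matrices and their symbols\<close>

text \<open>The sign convention is that of \<open>spectral_density\<close>; the lags stop at
  \<open>T - 1\<close> because a Toeplitz matrix of size \<open>T\<close> has no further
  diagonals.\<close>

definition truncated_symbol :: "nat \<Rightarrow> (int \<Rightarrow> complex) \<Rightarrow> real \<Rightarrow> complex" where
  "truncated_symbol T a lam = (\<Sum>k\<in>{- int T<..<int T}. a k * cis (- of_int k * lam))"

definition grid :: "nat \<Rightarrow> nat \<Rightarrow> real" where
  "grid L i = 2 * pi * real i / real L"

lemma mult_cis_cnj_mult_cis: "(a * cis u) * cnj (b * cis v) = a * cnj b * cis (u - v)"
proof -
  have "cis (u - v) = cis u * cis (- v)" by (simp add: cis_mult)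
  then show ?thesis by (simp add: cis_cnj mult_ac)
qed

text \<open>Orthogonality of characters: a geometric sum over an \<open>L\<close>-th root of unity,
  where the bound on \<open>m\<close> excludes nonzero multiples of \<open>L\<close>.\<close>

lemma sum_cis_grid:
  assumes "\<bar>m\<bar> < int L"
  shows "(\<Sum>i<L. cis (of_int m * grid L i)) = (if m = 0 then of_nat L else 0)"
proof (cases "m = 0")
  case False
  define z where "z = cis (2 * pi * of_int m / real L)"
  have L: "L > 0" using assms by auto
  have pow: "cis (of_int m * grid L i) = z ^ i" for i
    by (simp add: z_def grid_def Complex.DeMoivre mult_ac)
  have "z ^ L = cis (2 * pi * of_int m)"
    using L by (simp add: z_def Complex.DeMoivre)
  then have zL: "z ^ L = 1" by (simp add: cis_multiple_2pi)
  have z1: "z \<noteq> 1"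
  proof
    assume "z = 1"
    then have "exp (\<i> * complex_of_real (2 * pi * of_int m / real L)) = 1"
      by (simp add: z_def cis_conv_exp)
    then obtain n :: int where "2 * pi * of_int m / real L = of_int (2 * n) * pi"
      by (auto simp: exp_eq_1)
    then have "of_int m = of_int n * real L" using L by (simp add: field_simps)
    then have "of_int m = (of_int (n * int L) :: real)" by simp
    then have m: "m = n * int L" by (simp only: of_int_eq_iff)
    then have "n \<noteq> 0" using False by auto
    then have "int L \<le> \<bar>n\<bar> * int L" using mult_right_mono[of 1 "\<bar>n\<bar>" "int L"] by simp
    then show False using assms m by (simp add: abs_mult)
  qed
  show ?thesis
    using False z1 zL by (simp add: pow geometric_sum)
qed simp

text \<open>The sign \<open>s\<close> covers the forward and the inverse transform, both
  unnormalised, at once. The bound needed for orthogonality holds because two indices below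
  \<open>L\<close> differ by less than \<open>L\<close>.\<close>

lemma dft_parseval:
  fixes x :: "nat \<Rightarrow> complex" and s :: int
  assumes s: "\<bar>s\<bar> = 1"
  shows "(\<Sum>j<L. (cmod (\<Sum>i<L. x i * cis (of_int s * real i * grid L j)))\<^sup>2) = L * (\<Sum>i<L. (cmod (x i))\<^sup>2)"
proof -
  have "complex_of_real (\<Sum>j<L. (cmod (\<Sum>i<L. x i * cis (of_int s * real i * grid L j)))\<^sup>2) =
      (\<Sum>j<L. \<Sum>i<L. \<Sum>k<L. x i * cnj (x k) * cis (of_int (s * (int i - int k)) * grid L j))"
    by (simp only: of_real_sum complex_norm_square cnj_sum sum_product mult_cis_cnj_mult_cis)
       (simp add: algebra_simps)
  also have "\<dots> = (\<Sum>i<L. \<Sum>k<L. x i * cnj (x k) * (\<Sum>j<L. cis (of_int (s * (int i - int k)) * grid L j)))"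
    unfolding sum_distrib_left
    by (rule trans[OF sum.swap], rule sum.cong[OF refl], rule sum.swap)
  also have "\<dots> = (\<Sum>i<L. \<Sum>k<L. if k = i then x i * cnj (x i) * of_nat L else 0)"
  proof (intro sum.cong refl)
    fix i k assume "i \<in> {..<L}" "k \<in> {..<L}"
    then have "\<bar>s * (int i - int k)\<bar> < int L" using s by (auto simp: abs_mult)
    moreover have "s * (int i - int k) = 0 \<longleftrightarrow> k = i" using s by auto
    ultimately show "x i * cnj (x k) * (\<Sum>j<L. cis (of_int (s * (int i - int k)) * grid L j)) =
        (if k = i then x i * cnj (x i) * of_nat L else 0)"
      by (simp only: sum_cis_grid) auto
  qed
  also have "\<dots> = complex_of_real (L * (\<Sum>i<L. (cmod (x i))\<^sup>2))"
    by (simp only: of_real_mult of_real_sum complex_norm_square) (simp add: sum_distrib_left mult_ac)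
  finally show ?thesis by (simp only: of_real_eq_iff)
qed

text \<open>Two lags below \<open>T\<close> in modulus differ by less than \<open>2 * T\<close>, so
  sampling at \<open>2 * T\<close> frequencies causes no aliasing.\<close>

lemma truncated_symbol_inversion:
  assumes "\<bar>k\<bar> < int T"
  shows "(\<Sum>i<2*T. truncated_symbol T a (grid (2*T) i) * cis (of_int k * grid (2*T) i)) = of_nat (2*T) * a k"
proof -
  have "(\<Sum>i<2*T. truncated_symbol T a (grid (2*T) i) * cis (of_int k * grid (2*T) i)) =
     (\<Sum>l\<in>{- int T<..<int T}. a l * (\<Sum>i<2*T. cis (of_int (k - l) * grid (2*T) i)))"
    unfolding truncated_symbol_def sum_distrib_right sum_distrib_left
    by (subst sum.swap) (simp add: cis_mult algebra_simps)
  also have "\<dots> = (\<Sum>l\<in>{- int T<..<int T}. if l = k then a l * of_nat (2*T) else 0)"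
  proof (intro sum.cong refl)
    fix l assume "l \<in> {- int T<..<int T}"
    then have "\<bar>k - l\<bar> < int (2*T)" using assms by auto
    then show "a l * (\<Sum>i<2*T. cis (of_int (k - l) * grid (2*T) i)) = (if l = k then a l * of_nat (2*T) else 0)"
      by (simp only: sum_cis_grid) auto
  qed
  also have "\<dots> = of_nat (2*T) * a k"
    using assms by (subst sum.delta) auto
  finally show ?thesis .
qed

lemma vec_l2norm_sq: "(vec_l2norm v)\<^sup>2 = (\<Sum>i<dim_vec v. (cmod (v $ i))\<^sup>2)"
  by (simp add: vec_l2norm_def L2_set_def sum_nonneg)

text \<open>The circulant embedding, written with discrete Fourier transforms, in which the
  circulant matrix acts as multiplication by the sampled symbol.\<close>

lemma vec_l2norm_toeplitz_le:
  assumes "0 < T" and v: "v \<in> carrier_vec T"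
    and m: "\<And>i. i < 2*T \<Longrightarrow> cmod (truncated_symbol T a (grid (2*T) i)) \<le> m"
  shows "vec_l2norm (toeplitz T a *\<^sub>v v) \<le> m * vec_l2norm v"
proof -
  define L where "L = 2*T"
  have L: "0 < L" "T \<le> L" using assms by (auto simp: L_def)
  \<comment> \<open>Zero padding to length \<open>2 * T\<close>; \<open>u\<close> is the transform
    of the padded vector, \<open>y\<close> its product with the symbol, and \<open>z\<close> the
    unnormalised inverse transform.\<close>
  define x where "x = (\<lambda>l. if l < T then v $ l else 0)"
  define u where "u = (\<lambda>i. \<Sum>l<L. x l * cis (of_int 1 * real l * grid L i))"
  define y where "y = (\<lambda>i. truncated_symbol T a (grid L i) * u i)"
  define z where "z = (\<lambda>j. \<Sum>i<L. y i * cis (of_int (-1) * real i * grid L j))"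
  have m0: "0 \<le> m" using order_trans[OF norm_ge_zero m[of 0]] \<open>0 < T\<close> by simp
  have cis_grid: "cis (of_int (int l - int j) * grid L i) =
      cis (of_int 1 * real l * grid L i) * cis (of_int (-1) * real i * grid L j)" for i j l
    unfolding cis_mult by (rule arg_cong[of _ _ cis]) (simp add: grid_def algebra_simps add_divide_distrib diff_divide_distrib)
  \<comment> \<open>On the first \<open>T\<close> coordinates the circulant and Toeplitz products
    agree, since \<open>l - j\<close> stays in the range where inversion is exact.\<close>
  have z: "z j = of_nat L * (toeplitz T a *\<^sub>v v) $ j" if "j < T" for j
  proof -
    have "z j = (\<Sum>i<L. \<Sum>l<L. x l * (truncated_symbol T a (grid L i) * cis (of_int (int l - int j) * grid L i)))"
      unfolding z_def y_def u_def sum_distrib_left sum_distrib_right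
      by (intro sum.cong refl, subst cis_grid) (simp only: mult_ac)
    also have "\<dots> = (\<Sum>l<L. x l * (\<Sum>i<L. truncated_symbol T a (grid L i) * cis (of_int (int l - int j) * grid L i)))"
      unfolding sum_distrib_left by (rule sum.swap)
    also have "\<dots> = (\<Sum>l<T. x l * (\<Sum>i<L. truncated_symbol T a (grid L i) * cis (of_int (int l - int j) * grid L i)))"
      by (rule sum.mono_neutral_right) (use L in \<open>auto simp: x_def\<close>)
    also have "\<dots> = (\<Sum>l<T. x l * (of_nat L * a (int l - int j)))"
      using that unfolding L_def by (intro sum.cong refl, subst truncated_symbol_inversion) auto
    also have "\<dots> = of_nat L * (\<Sum>l<T. a (int l - int j) * v $ l)"
      by (simp add: sum_distrib_left x_def mult_ac)
    also have "(\<Sum>l<T. a (int l - int j) * v $ l) = (toeplitz T a *\<^sub>v v) $ j"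
      using that v by (simp add: toeplitz_def scalar_prod_def atLeast0LessThan)
    finally show ?thesis .
  qed
  have "(real L)\<^sup>2 * (vec_l2norm (toeplitz T a *\<^sub>v v))\<^sup>2 = (\<Sum>j<T. (cmod (z j))\<^sup>2)"
    by (simp add: vec_l2norm_sq z norm_mult power_mult_distrib sum_distrib_left toeplitz_def)
  \<comment> \<open>Discarding the coordinates from \<open>T\<close> on is the compression. The two
    uses of Parseval that follow each supply a factor \<open>L\<close>, which cancels the square of
    \<open>L\<close> on the left.\<close>
  also have "\<dots> \<le> (\<Sum>j<L. (cmod (z j))\<^sup>2)"
    by (rule sum_mono2) (use L in auto)
  also have "\<dots> = L * (\<Sum>i<L. (cmod (y i))\<^sup>2)"
    unfolding z_def by (rule dft_parseval) simp
  also have "\<dots> \<le> L * (\<Sum>i<L. m\<^sup>2 * (cmod (u i))\<^sup>2)"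
  proof (intro mult_left_mono sum_mono)
    fix i assume "i \<in> {..<L}"
    then have "cmod (y i) \<le> m * cmod (u i)"
      using m[of i] unfolding y_def norm_mult by (intro mult_right_mono) (auto simp: L_def)
    then show "(cmod (y i))\<^sup>2 \<le> m\<^sup>2 * (cmod (u i))\<^sup>2"
      unfolding power_mult_distrib[symmetric] by (intro power_mono) auto
  qed simp
  also have "\<dots> = L * m\<^sup>2 * (\<Sum>i<L. (cmod (u i))\<^sup>2)"
    by (simp add: sum_distrib_left mult_ac)
  also have "(\<Sum>i<L. (cmod (u i))\<^sup>2) = L * (\<Sum>i<L. (cmod (x i))\<^sup>2)"
    unfolding u_def by (rule dft_parseval) simp
  also have "(\<Sum>i<L. (cmod (x i))\<^sup>2) = (\<Sum>i<T. (cmod (x i))\<^sup>2)"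
    by (rule sum.mono_neutral_right) (use L in \<open>auto simp: x_def\<close>)
  also have "\<dots> = (vec_l2norm v)\<^sup>2"
    using v by (simp add: vec_l2norm_sq x_def)
  finally have "(real L)\<^sup>2 * (vec_l2norm (toeplitz T a *\<^sub>v v))\<^sup>2 \<le> (real L)\<^sup>2 * (m * vec_l2norm v)\<^sup>2"
    by (simp add: power_mult_distrib power2_eq_square mult_ac)
  then have "(vec_l2norm (toeplitz T a *\<^sub>v v))\<^sup>2 \<le> (m * vec_l2norm v)\<^sup>2"
    using L by simp
  then show ?thesis
    by (rule power2_le_imp_le) (use m0 in \<open>auto simp: vec_l2norm_def\<close>)
qed

lemma spectral_norm_toeplitz_le:
  assumes "0 < T"
    and m: "\<And>i. i < 2*T \<Longrightarrow> cmod (truncated_symbol T a (grid (2*T) i)) \<le> m"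
  shows "spectral_norm (toeplitz T a) \<le> m"
proof -
  have m0: "0 \<le> m" using order_trans[OF norm_ge_zero m[of 0]] \<open>0 < T\<close> by simp
  have dim: "dim_col (toeplitz T a) = T" by (simp add: toeplitz_def)
  \<comment> \<open>A bound on a real supremum needs a nonempty index set; the zero vector provides
    it.\<close>
  have "vec_l2norm (0\<^sub>v T) \<le> 1" by (simp add: vec_l2norm_def L2_set_def)
  then have "0\<^sub>v T \<in> {v \<in> carrier_vec T. vec_l2norm v \<le> 1}" by simp
  then have "{v \<in> carrier_vec T. vec_l2norm v \<le> 1} \<noteq> {}" by blast
  then show ?thesis
    unfolding spectral_norm_def dim
  proof (rule cSUP_least)
    fix v :: "complex vec" assume v: "v \<in> {v \<in> carrier_vec T. vec_l2norm v \<le> 1}"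
    then have "vec_l2norm (toeplitz T a *\<^sub>v v) \<le> m * vec_l2norm v"
      using assms by (intro vec_l2norm_toeplitz_le) auto
    also have "\<dots> \<le> m * 1" using v m0 by (intro mult_left_mono) auto
    finally show "vec_l2norm (toeplitz T a *\<^sub>v v) \<le> m" by simp
  qed
qed

section \<open>The symbol of the estimator and sums along diagonals\<close>

lemma toeplitz_minus: "toeplitz T a - toeplitz T b = toeplitz T (\<lambda>k. a k - b k)"
  by (rule eq_matI) (auto simp: toeplitz_def)

lemma truncated_symbol_minus:
  "truncated_symbol T (\<lambda>k. a k - b k) lam = truncated_symbol T a lam - truncated_symbol T b lam"
  by (simp add: truncated_symbol_def sum_subtractf left_diff_distrib)

text \<open>Pairs of times are regrouped by their lag; the condition is the truncation that occurs
  in \<open>biased_autocov\<close>.\<close>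

lemma sum_diagonals:
  "(\<Sum>k\<in>{- int T<..<int T}. \<Sum>t<T. if 0 \<le> int t + k \<and> int t + k \<le> int T - 1 then g (nat (int t + k)) t k else 0) =
   (\<Sum>t<T. \<Sum>s<T. g s t (int s - int t))"
proof (subst sum.swap, intro sum.cong refl)
  fix t assume t: "t \<in> {..<T}"
  have "(\<Sum>k\<in>{- int T<..<int T}. if 0 \<le> int t + k \<and> int t + k \<le> int T - 1 then g (nat (int t + k)) t k else 0) =
    (\<Sum>k\<in>{k\<in>{- int T<..<int T}. 0 \<le> int t + k \<and> int t + k \<le> int T - 1}. g (nat (int t + k)) t k)"
    by (rule sum.inter_filter[symmetric]) simp
  also have "\<dots> = (\<Sum>s<T. g s t (int s - int t))"
    by (rule sum.reindex_bij_witness[of _ "\<lambda>s. int s - int t" "\<lambda>k. nat (int t + k)"]) (use t in auto)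
  finally show "(\<Sum>k\<in>{- int T<..<int T}. if 0 \<le> int t + k \<and> int t + k \<le> int T - 1 then g (nat (int t + k)) t k else 0) =
    (\<Sum>s<T. g s t (int s - int t))" .
qed

text \<open>Dividing every lag by the same \<open>N * T\<close>, rather than by the number of
  available products, makes the symbol a sum of squared moduli: the periodogram averaged over the
  rows.\<close>

lemma truncated_symbol_biased_autocov:
  "truncated_symbol T (biased_autocov N T V) lam =
    of_real ((\<Sum>n<N. (cmod (\<Sum>t<T. V $$ (n, t) * cis (- real t * lam)))\<^sup>2) / (real N * real T))"
proof -
  have "truncated_symbol T (biased_autocov N T V) lam = 1 / (of_nat N * of_nat T) *
     (\<Sum>n<N. \<Sum>k\<in>{- int T<..<int T}. \<Sum>t<T. if 0 \<le> int t + k \<and> int t + k \<le> int T - 1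
        then V $$ (n, nat (int t + k)) * cnj (V $$ (n, t)) * cis (- of_int k * lam) else 0)"
  proof -
    have "truncated_symbol T (biased_autocov N T V) lam = (\<Sum>k\<in>{- int T<..<int T}. \<Sum>n<N.
       1 / (of_nat N * of_nat T) * (\<Sum>t<T. if 0 \<le> int t + k \<and> int t + k \<le> int T - 1
        then V $$ (n, nat (int t + k)) * cnj (V $$ (n, t)) * cis (- of_int k * lam) else 0))"
      unfolding truncated_symbol_def biased_autocov_def sum_distrib_left sum_distrib_right
      by (intro sum.cong refl) simp
    also have "\<dots> = (\<Sum>n<N. \<Sum>k\<in>{- int T<..<int T}.
       1 / (of_nat N * of_nat T) * (\<Sum>t<T. if 0 \<le> int t + k \<and> int t + k \<le> int T - 1
        then V $$ (n, nat (int t + k)) * cnj (V $$ (n, t)) * cis (- of_int k * lam) else 0))"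
      by (rule sum.swap)
    finally show ?thesis by (simp only: sum_distrib_left)
  qed
  also have "\<dots> = 1 / (of_nat N * of_nat T) *
     (\<Sum>n<N. \<Sum>t<T. \<Sum>s<T. V $$ (n, s) * cnj (V $$ (n, t)) * cis (- of_int (int s - int t) * lam))"
    by (subst sum_diagonals) (rule refl)
  also have "\<dots> = 1 / (of_nat N * of_nat T) *
     (\<Sum>n<N. (\<Sum>s<T. V $$ (n, s) * cis (- real s * lam)) * cnj (\<Sum>t<T. V $$ (n, t) * cis (- real t * lam)))"
  proof -
    have "(\<Sum>s<T. V $$ (n, s) * cis (- real s * lam)) * cnj (\<Sum>t<T. V $$ (n, t) * cis (- real t * lam)) =
        (\<Sum>t<T. \<Sum>s<T. V $$ (n, s) * cnj (V $$ (n, t)) * cis (- of_int (int s - int t) * lam))" for n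
      by (subst sum.swap) (simp only: cnj_sum sum_product mult_cis_cnj_mult_cis, simp add: algebra_simps)
    then show ?thesis by simp
  qed
  also have "\<dots> = of_real ((\<Sum>n<N. (cmod (\<Sum>t<T. V $$ (n, t) * cis (- real t * lam)))\<^sup>2) / (real N * real T))"
    by (simp only: of_real_divide of_real_sum complex_norm_square) simp
  finally show ?thesis .
qed

text \<open>Lag \<open>k\<close> occurs at \<open>T - \<bar>k\<bar>\<close> places; divided by
  \<open>T\<close>, these counts are the Fejer weights.\<close>

lemma sum_toeplitz_diagonals:
  "(\<Sum>t<T. \<Sum>s<T. f (int s - int t)) = (\<Sum>k\<in>{- int T<..<int T}. of_real (real T - \<bar>real_of_int k\<bar>) * (f k :: complex))"
proof -
  have "(\<Sum>t<T. \<Sum>s<T. f (int s - int t)) =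
    (\<Sum>k\<in>{- int T<..<int T}. \<Sum>t<T. if 0 \<le> int t + k \<and> int t + k \<le> int T - 1 then f k else 0)"
    by (rule sum_diagonals[symmetric])
  also have "\<dots> = (\<Sum>k\<in>{- int T<..<int T}. of_real (real T - \<bar>real_of_int k\<bar>) * f k)"
  proof (intro sum.cong refl)
    fix k assume k: "k \<in> {- int T<..<int T}"
    \<comment> \<open>Since \<open>nat\<close> sends negative numbers to zero, one interval covers
      both signs: a negative lag cuts off the start, a positive one the end.\<close>
    have "{t\<in>{..<T}. 0 \<le> int t + k \<and> int t + k \<le> int T - 1} = {nat (- k)..<T - nat k}"
      by auto
    then have "(\<Sum>t<T. if 0 \<le> int t + k \<and> int t + k \<le> int T - 1 then f k else 0) =
        of_nat (card {nat (- k)..<T - nat k}) * f k"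
      by (simp add: sum.inter_filter[symmetric])
    also have "real (card {nat (- k)..<T - nat k}) = real T - \<bar>real_of_int k\<bar>"
      using k by (auto simp: of_nat_diff abs_real_def)
    then have "(of_nat (card {nat (- k)..<T - nat k}) :: complex) = of_real (real T - \<bar>real_of_int k\<bar>)"
      by (metis of_real_of_nat_eq)
    finally show "(\<Sum>t<T. if 0 \<le> int t + k \<and> int t + k \<le> int T - 1 then f k else 0) =
        of_real (real T - \<bar>real_of_int k\<bar>) * f k" .
  qed
  finally show ?thesis .
qed

section \<open>Fejer means of the spectral density\<close>

definition fejer_mean :: "nat \<Rightarrow> (int \<Rightarrow> complex) \<Rightarrow> real \<Rightarrow> complex" where
  "fejer_mean T a lam = (\<Sum>k\<in>{- int T<..<int T}. of_real (1 - \<bar>real_of_int k\<bar> / T) * (a k * cis (- of_int k * lam)))"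

text \<open>The weight is \<open>\<bar>k\<bar> / T\<close> inside the Fejer window and one outside,
  so the sum dominates the distance of the Fejer mean both to the truncated symbol and to the
  spectral density.\<close>

definition fejer_bias :: "nat \<Rightarrow> (int \<Rightarrow> complex) \<Rightarrow> real" where
  "fejer_bias T a = (\<Sum>\<^sub>\<infinity>k\<in>UNIV. min (\<bar>real_of_int k\<bar> / T) 1 * cmod (a k))"

lemma fejer_weight_summable_on:
  assumes "(\<lambda>k. cmod (a k)) summable_on UNIV"
  shows "(\<lambda>k. min (\<bar>real_of_int k\<bar> / real T) 1 * cmod (a k)) summable_on A"
proof (rule summable_on_comparison_test)
  show "(\<lambda>k. cmod (a k)) summable_on A"
    using assms by (rule summable_on_subset_banach) simp
  show "min (\<bar>real_of_int k\<bar> / real T) 1 * cmod (a k) \<le> cmod (a k)" for k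
    by (rule mult_left_le_one_le) auto
qed auto

lemma fejer_bias_nonneg: "0 \<le> fejer_bias T a"
  unfolding fejer_bias_def by (rule infsum_nonneg) auto

text \<open>Dominated convergence by hand: all but \<open>e / 3\<close> of the absolute sum lies on
  a finite set, where the weights tend to zero; elsewhere they are at most one.\<close>

lemma fejer_bias_tendsto_0:
  assumes summable: "(\<lambda>k. cmod (a k)) summable_on UNIV"
  shows "(\<lambda>T. fejer_bias T a) \<longlonglongrightarrow> 0"
proof (rule LIMSEQ_I)
  fix e :: real assume "0 < e"
  then obtain F where F: "finite F" "dist (sum (\<lambda>k. cmod (a k)) F) (\<Sum>\<^sub>\<infinity>k. cmod (a k)) \<le> e / 3"
    using infsum_finite_approximation[OF summable, of "e / 3"] by auto
  have tail: "(\<Sum>\<^sub>\<infinity>k\<in>- F. cmod (a k)) \<le> e / 3"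
  proof -
    have "(\<Sum>\<^sub>\<infinity>k\<in>F \<union> - F. cmod (a k)) = (\<Sum>\<^sub>\<infinity>k\<in>F. cmod (a k)) + (\<Sum>\<^sub>\<infinity>k\<in>- F. cmod (a k))"
      by (rule infsum_Un_disjoint) (use F summable in \<open>auto intro: summable_on_subset_banach\<close>)
    then show ?thesis using F by (simp add: dist_real_def)
  qed
  have "(\<lambda>T. \<Sum>k\<in>F. \<bar>real_of_int k\<bar> / real T * cmod (a k)) \<longlonglongrightarrow> (\<Sum>k\<in>F. 0 * cmod (a k))"
    by (intro tendsto_intros lim_const_over_n)
  then have "eventually (\<lambda>T. (\<Sum>k\<in>F. \<bar>real_of_int k\<bar> / real T * cmod (a k)) < e / 3) sequentially"
    using \<open>0 < e\<close> by (intro order_tendstoD) auto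
  then obtain n where n: "(\<Sum>k\<in>F. \<bar>real_of_int k\<bar> / real T * cmod (a k)) < e / 3" if "T \<ge> n" for T
    by (auto simp: eventually_sequentially)
  have "norm (fejer_bias T a - 0) < e" if "T \<ge> n" for T
  proof -
    let ?w = "\<lambda>k. min (\<bar>real_of_int k\<bar> / real T) 1 * cmod (a k)"
    have "(\<Sum>\<^sub>\<infinity>k\<in>F \<union> - F. ?w k) = (\<Sum>\<^sub>\<infinity>k\<in>F. ?w k) + (\<Sum>\<^sub>\<infinity>k\<in>- F. ?w k)"
      by (rule infsum_Un_disjoint) (use summable in \<open>auto intro: fejer_weight_summable_on\<close>)
    then have "fejer_bias T a = (\<Sum>k\<in>F. ?w k) + (\<Sum>\<^sub>\<infinity>k\<in>- F. ?w k)"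
      using F by (simp add: fejer_bias_def)
    moreover have "(\<Sum>k\<in>F. ?w k) \<le> (\<Sum>k\<in>F. \<bar>real_of_int k\<bar> / real T * cmod (a k))"
      by (intro sum_mono mult_right_mono) auto
    moreover have "(\<Sum>\<^sub>\<infinity>k\<in>- F. ?w k) \<le> (\<Sum>\<^sub>\<infinity>k\<in>- F. cmod (a k))"
    proof (rule infsum_mono)
      show "(\<lambda>k. cmod (a k)) summable_on - F"
        using summable by (rule summable_on_subset_banach) simp
      show "?w k \<le> cmod (a k)" for k by (rule mult_left_le_one_le) auto
    qed (use summable in \<open>auto intro: fejer_weight_summable_on\<close>)
    ultimately show ?thesis
      using n[OF that] tail fejer_bias_nonneg[of T a] \<open>0 < e\<close> by simp
  qed
  then show "\<exists>n. \<forall>T\<ge>n. norm (fejer_bias T a - 0) < e" by blast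
qed

lemma truncated_symbol_fejer_mean:
  assumes summable: "(\<lambda>k. cmod (a k)) summable_on UNIV" and "0 < T"
  shows "cmod (fejer_mean T a lam - truncated_symbol T a lam) \<le> fejer_bias T a"
proof -
  have "fejer_mean T a lam - truncated_symbol T a lam =
      (\<Sum>k\<in>{- int T<..<int T}. - of_real (\<bar>real_of_int k\<bar> / T) * (a k * cis (- of_int k * lam)))"
    unfolding fejer_mean_def truncated_symbol_def sum_subtractf[symmetric]
    by (intro sum.cong refl) (simp add: algebra_simps)
  also have "cmod \<dots> \<le> (\<Sum>k\<in>{- int T<..<int T}. min (\<bar>real_of_int k\<bar> / T) 1 * cmod (a k))"
  proof (rule sum_norm_le)
    fix k assume "k \<in> {- int T<..<int T}"
    then have "\<bar>real_of_int k\<bar> / T \<le> 1" using \<open>0 < T\<close> by (simp add: abs_real_def)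
    then show "cmod (- of_real (\<bar>real_of_int k\<bar> / T) * (a k * cis (- of_int k * lam))) \<le>
        min (\<bar>real_of_int k\<bar> / T) 1 * cmod (a k)"
      by (simp add: norm_mult norm_divide)
  qed
  also have "\<dots> \<le> fejer_bias T a"
    unfolding fejer_bias_def
    by (rule finite_sum_le_infsum) (use summable in \<open>auto intro: fejer_weight_summable_on\<close>)
  finally show ?thesis .
qed

lemma spectral_density_cis:
  "spectral_density a lam = (\<Sum>\<^sub>\<infinity>k\<in>UNIV. a k * cis (- of_int k * lam))"
  unfolding spectral_density_def by (intro infsum_cong) (simp add: cis_conv_exp mult_ac)

lemma spectral_density_fejer_mean:
  assumes summable: "(\<lambda>k. cmod (a k)) summable_on UNIV" and "0 < T"
  shows "cmod (spectral_density a lam - fejer_mean T a lam) \<le> fejer_bias T a"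
proof -
  let ?w = "\<lambda>k. min (\<bar>real_of_int k\<bar> / real T) 1"
  let ?f = "\<lambda>k. a k * cis (- of_int k * lam)"
  have abs: "(\<lambda>k. norm (of_real (?w k) * ?f k)) summable_on UNIV"
    using fejer_weight_summable_on[OF summable, of T UNIV] by (simp add: norm_mult)
  \<comment> \<open>The complementary weights vanish outside the window, so this series is the
    finite Fejer sum.\<close>
  have fin: "((\<lambda>k. of_real (1 - ?w k) * ?f k) has_sum fejer_mean T a lam) UNIV"
  proof (rule has_sum_finite_neutralI)
    show "fejer_mean T a lam = (\<Sum>k\<in>{- int T<..<int T}. of_real (1 - ?w k) * ?f k)"
      unfolding fejer_mean_def
    proof (intro sum.cong refl)
      fix k assume "k \<in> {- int T<..<int T}"
      then have "\<bar>real_of_int k\<bar> / T \<le> 1" using \<open>0 < T\<close> by (simp add: abs_real_def)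
      then show "of_real (1 - \<bar>real_of_int k\<bar> / T) * ?f k = of_real (1 - ?w k) * ?f k"
        by simp
    qed
    show "of_real (1 - ?w k) * ?f k = 0" if "k \<in> UNIV - {- int T<..<int T}" for k
    proof -
      have "1 \<le> \<bar>real_of_int k\<bar> / T" using that \<open>0 < T\<close> by (auto simp: abs_real_def)
      then show ?thesis by simp
    qed
  qed auto
  have "(\<Sum>\<^sub>\<infinity>k. of_real (?w k) * ?f k + of_real (1 - ?w k) * ?f k) =
      (\<Sum>\<^sub>\<infinity>k. of_real (?w k) * ?f k) + (\<Sum>\<^sub>\<infinity>k. of_real (1 - ?w k) * ?f k)"
    by (rule infsum_add[OF abs_summable_summable[OF abs] has_sum_imp_summable[OF fin]])
  moreover have "(\<lambda>k. of_real (?w k) * ?f k + of_real (1 - ?w k) * ?f k) = ?f"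
    by (simp add: fun_eq_iff algebra_simps)
  ultimately have "spectral_density a lam - fejer_mean T a lam = (\<Sum>\<^sub>\<infinity>k. of_real (?w k) * ?f k)"
    using infsumI[OF fin] by (simp add: spectral_density_cis)
  also have "cmod \<dots> \<le> (\<Sum>\<^sub>\<infinity>k. norm (of_real (?w k) * ?f k))"
    using abs by (rule norm_infsum_bound)
  also have "\<dots> = fejer_bias T a"
    by (simp add: fejer_bias_def norm_mult)
  finally show ?thesis .
qed

lemma cmod_spectral_density_le_sup:
  assumes summable: "(\<lambda>k. cmod (a k)) summable_on UNIV" and "lam \<in> {0..<2 * pi}"
  shows "cmod (spectral_density a lam) \<le> spectral_density_sup a"
  unfolding spectral_density_sup_def
proof (rule cSUP_upper)
  \<comment> \<open>A real supremum bounds the values only if they are bounded above; the absolute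
    sum is a uniform bound.\<close>
  have "cmod (spectral_density a t) \<le> (\<Sum>\<^sub>\<infinity>k. cmod (a k))" for t
  proof -
    have "cmod (spectral_density a t) \<le> (\<Sum>\<^sub>\<infinity>k. norm (a k * cis (- of_int k * t)))"
      unfolding spectral_density_cis
      by (rule norm_infsum_bound) (use summable in \<open>simp add: norm_mult\<close>)
    then show ?thesis by (simp add: norm_mult)
  qed
  then show "bdd_above ((\<lambda>lam. cmod (spectral_density a lam)) ` {0..<2 * pi})"
    by (intro bdd_aboveI2)
qed fact

lemma grid_range: "i < L \<Longrightarrow> grid L i \<in> {0..<2 * pi}"
  by (simp add: grid_def divide_simps)

lemma cmod_fejer_mean_grid_le:
  assumes summable: "(\<lambda>k. cmod (a k)) summable_on UNIV" and "0 < T" "i < L"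
  shows "cmod (fejer_mean T a (grid L i)) \<le> spectral_density_sup a + fejer_bias T a"
proof -
  have "cmod (fejer_mean T a (grid L i)) \<le> cmod (spectral_density a (grid L i)) +
      cmod (spectral_density a (grid L i) - fejer_mean T a (grid L i))"
    by (metis norm_minus_commute norm_triangle_sub)
  then show ?thesis
    using cmod_spectral_density_le_sup[OF summable grid_range[OF \<open>i < L\<close>]]
      spectral_density_fejer_mean[OF summable \<open>0 < T\<close>, of "grid L i"] by linarith
qed

text \<open>By inversion at lag zero, \<open>a 0\<close> is the average of the truncated symbol over
  the grid, and the limit in \<open>T\<close> removes the bias. For \<open>r 0\<close> nonzero this
  makes the denominator of the final rate positive.\<close>

lemma cmod_le_spectral_density_sup:
  assumes summable: "(\<lambda>k. cmod (a k)) summable_on UNIV"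
  shows "cmod (a 0) \<le> spectral_density_sup a"
proof -
  have "cmod (a 0) \<le> spectral_density_sup a + 2 * fejer_bias T a" if "T \<ge> 1" for T
  proof -
    have T: "0 < T" using that by simp
    \<comment> \<open>The bias is paid twice: from the truncated symbol to the Fejer mean, and from
      there to the spectral density.\<close>
    have "cmod (truncated_symbol T a (grid (2*T) i)) \<le> spectral_density_sup a + 2 * fejer_bias T a"
      if "i < 2 * T" for i
    proof -
      have "cmod (truncated_symbol T a (grid (2*T) i)) \<le> cmod (fejer_mean T a (grid (2*T) i)) +
          cmod (fejer_mean T a (grid (2*T) i) - truncated_symbol T a (grid (2*T) i))"
        by (metis norm_minus_commute norm_triangle_sub)
      then show ?thesis
        using cmod_fejer_mean_grid_le[OF summable T that]
          truncated_symbol_fejer_mean[OF summable T, of "grid (2*T) i"] by linarith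
    qed
    then have "cmod (\<Sum>i<2*T. truncated_symbol T a (grid (2*T) i)) \<le>
        (\<Sum>i<2*T. spectral_density_sup a + 2 * fejer_bias T a)"
      by (intro sum_norm_le) auto
    moreover have "(\<Sum>i<2*T. truncated_symbol T a (grid (2*T) i)) = of_nat (2*T) * a 0"
      using truncated_symbol_inversion[of 0 T a] T by simp
    ultimately have "real (2 * T) * cmod (a 0) \<le> real (2 * T) * (spectral_density_sup a + 2 * fejer_bias T a)"
      by (simp add: norm_mult)
    then show ?thesis using T by (simp only: mult_le_cancel_left_pos of_nat_0_less_iff)
  qed
  moreover have "(\<lambda>T. spectral_density_sup a + 2 * fejer_bias T a) \<longlonglongrightarrow> spectral_density_sup a + 2 * 0"
    by (intro tendsto_intros fejer_bias_tendsto_0 summable)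
  ultimately show ?thesis
    by (intro LIMSEQ_le_const) auto
qed

text \<open>The left side is the squared norm of \<open>S\<close> applied to a Fourier vector,
  divided by \<open>T\<close>. It depends on \<open>S\<close> only through its Gram matrix, so every
  root gives the same value.\<close>

lemma sum_cmod_root_transform:
  assumes S: "S \<in> carrier_mat T T" and root: "mat_adjoint S * S = toeplitz T a" and "0 < T"
  shows "complex_of_real ((\<Sum>j<T. (cmod (\<Sum>t<T. S $$ (j, t) * cis (- real t * lam)))\<^sup>2) / T) = fejer_mean T a lam"
proof -
  have gram: "(\<Sum>j<T. S $$ (j, s) * cnj (S $$ (j, t))) = a (int s - int t)" if "s < T" "t < T" for s t
  proof -
    have "(mat_adjoint S * S) $$ (t, s) = (\<Sum>j<T. S $$ (j, s) * cnj (S $$ (j, t)))"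
      using S that by (simp add: mat_adjoint_def scalar_prod_def atLeast0LessThan mult_ac)
    then show ?thesis
      using that by (simp add: root toeplitz_def)
  qed
  have "complex_of_real (\<Sum>j<T. (cmod (\<Sum>t<T. S $$ (j, t) * cis (- real t * lam)))\<^sup>2) =
     (\<Sum>j<T. \<Sum>s<T. \<Sum>t<T. S $$ (j, s) * cnj (S $$ (j, t)) * cis (- real s * lam - - real t * lam))"
    by (simp only: of_real_sum complex_norm_square cnj_sum sum_product mult_cis_cnj_mult_cis)
  also have "\<dots> = (\<Sum>s<T. \<Sum>t<T. \<Sum>j<T. S $$ (j, s) * cnj (S $$ (j, t)) * cis (- real s * lam - - real t * lam))"
    by (rule trans[OF sum.swap], rule sum.cong[OF refl], rule sum.swap)
  also have "\<dots> = (\<Sum>s<T. \<Sum>t<T. a (int s - int t) * cis (- of_int (int s - int t) * lam))"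
  proof (intro sum.cong refl)
    fix s t assume "s \<in> {..<T}" "t \<in> {..<T}"
    then show "(\<Sum>j<T. S $$ (j, s) * cnj (S $$ (j, t)) * cis (- real s * lam - - real t * lam)) =
        a (int s - int t) * cis (- of_int (int s - int t) * lam)"
      unfolding sum_distrib_right[symmetric] by (simp add: gram) (simp add: algebra_simps)
  qed
  also have "\<dots> = (\<Sum>t<T. \<Sum>s<T. a (int s - int t) * cis (- of_int (int s - int t) * lam))"
    by (rule sum.swap)
  also have "\<dots> = (\<Sum>k\<in>{- int T<..<int T}. of_real (real T - \<bar>real_of_int k\<bar>) * (a k * cis (- of_int k * lam)))"
    by (rule sum_toeplitz_diagonals)
  also have "\<dots> = of_nat T * fejer_mean T a lam"
    unfolding fejer_mean_def sum_distrib_left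
    using \<open>0 < T\<close> by (intro sum.cong refl) (simp add: field_simps)
  finally show ?thesis using \<open>0 < T\<close> by simp
qed

section \<open>The deviation inequality\<close>

text \<open>The bias enters \<open>y\<close> twice: \<open>x\<close> loses the distance from the
  Fejer mean to the target symbol, and the variance bound gains the distance from the Fejer mean to
  the spectral density. The factor \<open>4 * T\<close> counts two tails at each of
  \<open>2 * T\<close> frequencies.\<close>

lemma toeplitz_deviation_bound:
  assumes M: "prob_space M" and W: "std_complex_gaussian_matrix M N T W" and "0 < N" "0 < T"
    and S: "S \<in> carrier_mat T T" and root: "mat_adjoint S * S = toeplitz T a"
    and summable: "(\<lambda>k. cmod (a k)) summable_on UNIV"
    and pos: "0 < spectral_density_sup a" and x: "fejer_bias T a < x"
  defines "y \<equiv> (x - fejer_bias T a) / (spectral_density_sup a + fejer_bias T a)"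
  shows "\<P>(\<omega> in M. spectral_norm (toeplitz T (biased_autocov N T (W \<omega> * S)) - toeplitz T a) > x)
     \<le> 4 * real T * exp (- real N * (y - ln (1 + y)))"
proof -
  interpret prob_space M by fact
  define B where "B = spectral_density_sup a + fejer_bias T a"
  define h where "h = x - fejer_bias T a"
  \<comment> \<open>\<open>b i\<close> is the image under \<open>S\<close> of the
    \<open>i\<close>-th Fourier vector, scaled so that \<open>Q i / N\<close> is the symbol of the
    estimator and \<open>\<sigma> i\<close> its mean.\<close>
  define b where "b = (\<lambda>i j. (\<Sum>t<T. S $$ (j, t) * cis (- real t * grid (2*T) i)) / of_real (sqrt T))"
  define Q where "Q = (\<lambda>i \<omega>. \<Sum>n<N. (cmod (\<Sum>j<T. b i j * W \<omega> $$ (n, j)))\<^sup>2)"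
  define \<sigma> where "\<sigma> = (\<lambda>i. \<Sum>j<T. (cmod (b i j))\<^sup>2)"
  define A where "A = (\<lambda>i. {\<omega> \<in> space M. \<bar>Q i \<omega> / N - \<sigma> i\<bar> \<ge> h})"
  have B: "0 < B" using pos fejer_bias_nonneg[of T a] by (simp add: B_def)
  have h: "0 < h" using x by (simp add: h_def)
  have \<sigma>: "complex_of_real (\<sigma> i) = fejer_mean T a (grid (2*T) i)" for i
  proof -
    have "\<sigma> i = (\<Sum>j<T. (cmod (\<Sum>t<T. S $$ (j, t) * cis (- real t * grid (2*T) i)))\<^sup>2) / T"
      unfolding \<sigma>_def b_def norm_divide power_divide sum_divide_distrib[symmetric] by simp
    then show ?thesis using sum_cmod_root_transform[OF S root \<open>0 < T\<close>] by simp
  qed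
  have \<sigma>B: "\<sigma> i \<le> B" if "i < 2 * T" for i
  proof -
    have "\<sigma> i \<le> cmod (complex_of_real (\<sigma> i))" by simp
    also have "\<dots> \<le> B"
      unfolding \<sigma> B_def by (rule cmod_fejer_mean_grid_le) (use summable \<open>0 < T\<close> that in auto)
    finally show ?thesis .
  qed
  have symbol: "truncated_symbol T (biased_autocov N T (W \<omega> * S)) (grid (2*T) i) = of_real (Q i \<omega> / N)"
    if "\<omega> \<in> space M" for \<omega> i
  proof -
    have Wc: "W \<omega> \<in> carrier_mat N T" using W that by (auto simp: std_complex_gaussian_matrix_def)
    have "(cmod (\<Sum>t<T. (W \<omega> * S) $$ (n, t) * cis (- real t * grid (2*T) i)))\<^sup>2 =
        T * (cmod (\<Sum>j<T. b i j * W \<omega> $$ (n, j)))\<^sup>2" if "n < N" for n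
    proof -
      have "(\<Sum>t<T. (W \<omega> * S) $$ (n, t) * cis (- real t * grid (2*T) i)) =
        (\<Sum>t<T. \<Sum>j<T. W \<omega> $$ (n, j) * S $$ (j, t) * cis (- real t * grid (2*T) i))"
        using Wc S that by (intro sum.cong refl)
          (simp add: scalar_prod_def atLeast0LessThan sum_distrib_right)
      also have "\<dots> = (\<Sum>j<T. \<Sum>t<T. W \<omega> $$ (n, j) * S $$ (j, t) * cis (- real t * grid (2*T) i))"
        by (rule sum.swap)
      also have "\<dots> = of_real (sqrt T) * (\<Sum>j<T. b i j * W \<omega> $$ (n, j))"
        using \<open>0 < T\<close> by (simp add: b_def sum_distrib_left sum_distrib_right sum_divide_distrib mult_ac)
      finally show ?thesis by (simp add: norm_mult power_mult_distrib)
    qed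
    then show ?thesis
      using \<open>0 < T\<close> by (simp add: truncated_symbol_biased_autocov Q_def flip: sum_distrib_left)
  qed
  \<comment> \<open>The event need not be known to be measurable: only the covering events \<open>A i\<close> are.\<close>
  have sub: "{\<omega> \<in> space M. spectral_norm (toeplitz T (biased_autocov N T (W \<omega> * S)) - toeplitz T a) > x}
      \<subseteq> (\<Union>i<2*T. A i)"
  proof (rule subsetI, rule ccontr)
    fix \<omega> assume \<omega>: "\<omega> \<in> {\<omega> \<in> space M. spectral_norm (toeplitz T (biased_autocov N T (W \<omega> * S)) - toeplitz T a) > x}"
      and "\<omega> \<notin> (\<Union>i<2*T. A i)"
    then have small: "\<bar>Q i \<omega> / N - \<sigma> i\<bar> < h" if "i < 2 * T" for i
      using that by (auto simp: A_def not_le)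
    have "spectral_norm (toeplitz T (biased_autocov N T (W \<omega> * S)) - toeplitz T a) \<le> x"
      unfolding toeplitz_minus
    proof (rule spectral_norm_toeplitz_le)
      fix i assume i: "i < 2 * T"
      let ?l = "grid (2*T) i"
      \<comment> \<open>Random fluctuation plus deterministic bias; \<open>h\<close> was chosen so
        that the two bounds add up to \<open>x\<close>.\<close>
      have "truncated_symbol T (\<lambda>k. biased_autocov N T (W \<omega> * S) k - a k) ?l =
          of_real (Q i \<omega> / N - \<sigma> i) + (fejer_mean T a ?l - truncated_symbol T a ?l)"
        using \<omega> symbol[of \<omega> i] by (simp add: truncated_symbol_minus flip: \<sigma>)
      also have "cmod \<dots> \<le> cmod (of_real (Q i \<omega> / N - \<sigma> i)) + cmod (fejer_mean T a ?l - truncated_symbol T a ?l)"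
        by (rule norm_triangle_ineq)
      also have "\<dots> \<le> h + fejer_bias T a"
        using small[OF i] truncated_symbol_fejer_mean[OF summable \<open>0 < T\<close>, of ?l]
        unfolding norm_of_real by linarith
      finally show "cmod (truncated_symbol T (\<lambda>k. biased_autocov N T (W \<omega> * S) k - a k) ?l) \<le> x"
        by (simp add: h_def)
    qed fact
    then show False using \<omega> by simp
  qed
  have A: "A i \<in> sets M" "measure M (A i) \<le> 2 * exp (- real N * (h / B - ln (1 + h / B)))"
    if "i < 2 * T" for i
    unfolding A_def Q_def \<sigma>_def
    by (rule gaussian_rows_concentration[OF M W \<open>0 < T\<close> \<open>0 < N\<close> \<sigma>B[OF that, unfolded \<sigma>_def] B h])+
  have "\<P>(\<omega> in M. spectral_norm (toeplitz T (biased_autocov N T (W \<omega> * S)) - toeplitz T a) > x)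
      \<le> measure M (\<Union>i<2*T. A i)"
    by (rule finite_measure_mono[OF sub], rule sets.finite_UN) (use A in auto)
  also have "\<dots> \<le> (\<Sum>i<2*T. measure M (A i))"
    by (rule finite_measure_subadditive_finite) (use A in auto)
  also have "\<dots> \<le> (\<Sum>i<2*T. 2 * exp (- real N * (h / B - ln (1 + h / B))))"
    by (rule sum_mono) (use A in auto)
  also have "\<dots> = 4 * real T * exp (- real N * (y - ln (1 + y)))"
    by (simp add: y_def h_def B_def)
  finally show ?thesis .
qed

section \<open>Absorbing the bias, the union bound and the ratio \<open>N / T\<close> into the
  \<open>o(1)\<close> term\<close>

theorem theorem1:
  fixes r :: "int \<Rightarrow> complex"
    and N :: "nat \<Rightarrow> nat"
    and c x :: real
    and M :: "nat \<Rightarrow> 'a measure"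
    and W :: "nat \<Rightarrow> 'a \<Rightarrow> complex mat"
    and S :: "nat \<Rightarrow> complex mat"
  defines "V \<equiv> \<lambda>T \<omega>. W T \<omega> * S T"
  assumes cov: "covariance_coefficients r"
    and summable: "(\<lambda>k. cmod (r k)) summable_on UNIV"
    and r0: "r 0 \<noteq> 0"
    and N_pos: "\<And>T. T \<ge> 1 \<Longrightarrow> N T \<ge> 1"
    and c_pos: "0 < c"
    and N_lim: "(\<lambda>T. real (N T) / real T) \<longlonglongrightarrow> c"
    and prob: "\<And>T. T \<ge> 1 \<Longrightarrow> prob_space (M T)"
    and gauss: "\<And>T. T \<ge> 1 \<Longrightarrow> std_complex_gaussian_matrix (M T) (N T) T (W T)"
    and S_carrier: "\<And>T. T \<ge> 1 \<Longrightarrow> S T \<in> carrier_mat T T"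
    and S_root: "\<And>T. T \<ge> 1 \<Longrightarrow> mat_adjoint (S T) * S T = toeplitz T r"
    and x_pos: "0 < x"
  shows "\<exists>\<epsilon> :: nat \<Rightarrow> real. \<epsilon> \<longlonglongrightarrow> 0 \<and>
    (\<forall>T\<ge>1.
      \<P>(\<omega> in M T.
          spectral_norm (toeplitz T (biased_autocov (N T) T (V T \<omega>)) - toeplitz T r) > x)
      \<le> exp (- c * real T *
               (x / spectral_density_sup r - ln (1 + x / spectral_density_sup r) + \<epsilon> T)))"
proof -
  define B where "B = spectral_density_sup r"
  define \<delta> where "\<delta> = (\<lambda>T. fejer_bias T r)"
  define \<phi> where "\<phi> = (\<lambda>y::real. y - ln (1 + y))"
  define y where "y = (\<lambda>T. (x - \<delta> T) / (B + \<delta> T))"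
  \<comment> \<open>The solution of \<open>4 * T * exp (- N * \<phi> (y T)) = exp (- c * T * (\<phi>
    (x / B) + \<epsilon>' T))\<close>.\<close>
  define \<epsilon>' where "\<epsilon>' = (\<lambda>T. (real (N T) / real T) * \<phi> (y T) / c - \<phi> (x / B) - ln (4 * real T) / real T / c)"
  \<comment> \<open>As long as the bias is at least \<open>x\<close>, which fails for all large
    \<open>T\<close>, this value makes the exponent zero and the bound trivial.\<close>
  define \<epsilon> where "\<epsilon> = (\<lambda>T. if \<delta> T < x then \<epsilon>' T else - \<phi> (x / B))"
  have "0 < cmod (r 0)" using r0 by simp
  also have "\<dots> \<le> B" unfolding B_def by (rule cmod_le_spectral_density_sup[OF summable])
  finally have B: "0 < B" .
  have \<delta>: "\<delta> \<longlonglongrightarrow> 0"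
    unfolding \<delta>_def by (rule fejer_bias_tendsto_0[OF summable])
  have xB: "0 < x / B" using x_pos B by simp
  have "y \<longlonglongrightarrow> (x - 0) / (B + 0)"
    unfolding y_def using B by (intro tendsto_intros \<delta>) auto
  then have "(\<lambda>T. \<phi> (y T)) \<longlonglongrightarrow> \<phi> (x / B)"
    unfolding \<phi>_def using xB by (intro tendsto_intros) auto
  moreover have "(\<lambda>T::nat. ln (4 * real T) / real T) \<longlonglongrightarrow> 0"
    by real_asymp
  ultimately have "\<epsilon>' \<longlonglongrightarrow> c * \<phi> (x / B) / c - \<phi> (x / B) - 0 / c"
    unfolding \<epsilon>'_def using c_pos by (intro tendsto_intros N_lim) auto
  then have "\<epsilon>' \<longlonglongrightarrow> 0" using c_pos by simp
  moreover have "eventually (\<lambda>T. \<epsilon>' T = \<epsilon> T) sequentially"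
    using order_tendstoD(2)[OF \<delta> x_pos] by eventually_elim (simp add: \<epsilon>_def)
  ultimately have "\<epsilon> \<longlonglongrightarrow> 0"
    by (rule Lim_transform_eventually)
  moreover have "\<P>(\<omega> in M T. spectral_norm (toeplitz T (biased_autocov (N T) T (V T \<omega>)) - toeplitz T r) > x)
      \<le> exp (- c * real T * (\<phi> (x / B) + \<epsilon> T))" if "T \<ge> 1" for T
  proof (cases "\<delta> T < x")
    case False
    then show ?thesis
      using prob_space.prob_le_1[OF prob[OF that]] by (simp add: \<epsilon>_def)
  next
    case True
    have T: "0 < T" "0 < N T" using that N_pos[OF that] by auto
    have "\<P>(\<omega> in M T. spectral_norm (toeplitz T (biased_autocov (N T) T (V T \<omega>)) - toeplitz T r) > x)
      \<le> 4 * real T * exp (- real (N T) * \<phi> (y T))"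
      unfolding V_def \<phi>_def y_def \<delta>_def B_def
      by (rule toeplitz_deviation_bound)
         (use T B True that in \<open>auto simp: B_def \<delta>_def intro: prob gauss S_carrier S_root summable\<close>)
    also have "\<dots> = exp (ln (4 * real T) - real (N T) * \<phi> (y T))"
      using T by (simp add: exp_diff exp_minus divide_inverse)
    also have "ln (4 * real T) - real (N T) * \<phi> (y T) = - c * real T * (\<phi> (x / B) + \<epsilon> T)"
      using True T c_pos by (simp add: \<epsilon>_def \<epsilon>'_def field_simps)
    finally show ?thesis .
  qed
  ultimately show ?thesis
    unfolding \<phi>_def B_def by blast
qed

end
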